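(* Let $G$ be a digraph, let $x,y$ be vertices of $G$, and let $\alpha,\beta$ be two path maps on $G$ from $x$ to $y$. Then $\alpha$ and $\beta$ are elementarily equivalent if and only if $$\int_{\alpha}\omega_1\cdots\omega_r=\int_{\beta}\omega_1\cdots\omega_r$$ for all $r\ge 1$ and all $1$-forms $\omega_1,\ldots,\omega_r$ on $G$.
   Context: $\mathbb{K}$ is a fixed field of characteristic $0$. A digraph $G=(G_0,G_1)$ has a finite vertex set $G_0$ and arrow set $G_1\subset (G_0\times G_0)\setminus\{(v,v)\}$ (no self-loops; both $u\to v$ and $v\to u$ may be arrows). A digraph map $f\colon G\to H$ is a map $G_0\to H_0$ such that for each arrow $u\to v$ of $G$ either $f(u)=f(v)$ or $f(u)\to f(v)$ is an arrow of $H$. A line digraph $I_n$ ($n\ge 0$) has vertices $0,\ldots,n$ and, for each $0\le i<n$, exactly one of the arrows $i\to i+1$, $i+1\to i$, and no other arrows. A path map on $G$ is a digraph map $\alpha\colon I_n\to G$ for some line digraph $I_n$; it is a path map from $\alpha(0)$ to $\alpha(n)$. Inverse: $\alpha^{-1}\colon \widehat I_n\to G$, $\alpha^{-1}(i)=\alpha(n-i)$, where $\widehat I_n$ is the line digraph with $i\to j$ in $\widehat I_n$ iff $(n-i)\to(n-j)$ in $I_n$. Concatenation: if $\alpha\colon I_n\to G$, $\beta\colon I_m\to G$ and $\alpha(n)=\beta(0)$, then $\alpha\star\beta$ is the path map of length $n+m$ obtained by following $\alpha$ and then $\beta$ (on the line digraph obtained by gluing $I_m$ after $I_n$). A $1$-form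 on $G$ is a function $\omega\colon G_1\to\mathbb{K}$. For a path map $\alpha\colon I_n\to G$ and $1\le t\le n$, set $\langle\omega,\alpha_t\rangle=0$ if $\alpha(t-1)=\alpha(t)$; otherwise $\langle\omega,\alpha_t\rangle=\omega(\alpha(t-1)\to\alpha(t))$ if $(t-1)\to t$ is in $I_n$, and $\langle\omega,\alpha_t\rangle=-\omega(\alpha(t)\to\alpha(t-1))$ if $t\to (t-1)$ is in $I_n$. For a non-decreasing sequence of positive integers, $\tau(t_1,\ldots,t_r)=\prod_{k\ge1}\varphi_k!$, where $\varphi_k$ is the multiplicity of $k$ in the sequence. The iterated path integral is $$\int_\alpha\omega_1\cdots\omega_r=\sum_{1\le t_1\le\cdots\le t_r\le n}\frac{\prod_{i=1}^r\langle\omega_i,\alpha_{t_i}\rangle}{\tau(t_1,\ldots,t_r)}.$$ Elementary equivalence is the equivalence relation on path maps generated by: (1) $\gamma'\star\gamma\star\gamma^{-1}\star\gamma''\sim\gamma'\star\gamma''$ for path maps $\gamma,\gamma',\gamma''$ (possibly trivial) for which the concatenations are defined; (2) $\gamma'\star r\star\gamma''\sim\gamma'\star\gamma''$, where $r$ is a trivial arrow, i.e. a constant path map of length $1$ (with either orientation of $I_1$). *)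

theory Defs
  imports "Graph_Theory.Pair_Digraph" "HOL-Library.FuncSet"
begin

text \<open>
  A digraph is a \<open>pair_digraph\<close> of the Graph Theory entry: finite vertex set, arrows
  given by a relation on the vertices, no loops, antiparallel arrows allowed.

  Maps with a domain are represented extensionally (value \<open>undefined\<close> outside the
  domain), so that equality of HOL functions is equality of maps.
\<close>

definition digraph_map ::
  "'a pair_pre_digraph \<Rightarrow> 'b pair_pre_digraph \<Rightarrow> ('a \<Rightarrow> 'b) \<Rightarrow> bool" where
  "digraph_map G H f \<longleftrightarrow>
     f \<in> pverts G \<rightarrow>\<^sub>E pverts H \<and>
     (\<forall>(u, v) \<in> parcs G. f u = f v \<or> (f u, f v) \<in> parcs H)"

definition line_digraph :: "nat \<Rightarrow> nat pair_pre_digraph \<Rightarrow> bool" where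
  "line_digraph n I \<longleftrightarrow>
     pverts I = {0..n} \<and>
     (\<forall>i<n. (i, Suc i) \<in> parcs I \<longleftrightarrow> (Suc i, i) \<notin> parcs I) \<and>
     parcs I \<subseteq> (\<Union>i<n. {(i, Suc i), (Suc i, i)})"

record 'a dpath =
  plen :: nat
  pline :: "nat pair_pre_digraph"
  pmap :: "nat \<Rightarrow> 'a"

definition path_map :: "'a pair_pre_digraph \<Rightarrow> 'a dpath \<Rightarrow> bool" where
  "path_map G \<alpha> \<longleftrightarrow> line_digraph (plen \<alpha>) (pline \<alpha>) \<and> digraph_map (pline \<alpha>) G (pmap \<alpha>)"

definition psource :: "'a dpath \<Rightarrow> 'a" where
  "psource \<alpha> = pmap \<alpha> 0"

definition ptarget :: "'a dpath \<Rightarrow> 'a" where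
  "ptarget \<alpha> = pmap \<alpha> (plen \<alpha>)"

definition path_map_from_to :: "'a pair_pre_digraph \<Rightarrow> 'a \<Rightarrow> 'a \<Rightarrow> 'a dpath \<Rightarrow> bool" where
  "path_map_from_to G x y \<alpha> \<longleftrightarrow> path_map G \<alpha> \<and> psource \<alpha> = x \<and> ptarget \<alpha> = y"

definition pinverse :: "'a dpath \<Rightarrow> 'a dpath" where
  "pinverse \<alpha> = (let n = plen \<alpha> in
     \<lparr> plen = n,
       pline = \<lparr> pverts = {0..n},
                 parcs = {(i, j). i \<le> n \<and> j \<le> n \<and> (n - i, n - j) \<in> parcs (pline \<alpha>)} \<rparr>,
       pmap = (\<lambda>i\<in>{0..n}. pmap \<alpha> (n - i)) \<rparr>)"

text \<open>Meaningful when \<open>ptarget \<alpha> = psource \<beta>\<close>.\<close>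

definition pconcat :: "'a dpath \<Rightarrow> 'a dpath \<Rightarrow> 'a dpath" (infixl "\<star>" 70) where
  "\<alpha> \<star> \<beta> = (let n = plen \<alpha>; m = plen \<beta> in
     \<lparr> plen = n + m,
       pline = \<lparr> pverts = {0..n + m},
                 parcs = parcs (pline \<alpha>) \<union> {(n + i, n + j) | i j. (i, j) \<in> parcs (pline \<beta>)} \<rparr>,
       pmap = (\<lambda>i\<in>{0..n + m}. if i \<le> n then pmap \<alpha> i else pmap \<beta> (i - n)) \<rparr>)"

definition trivial_arrow :: "'a pair_pre_digraph \<Rightarrow> 'a dpath \<Rightarrow> bool" where
  "trivial_arrow G r \<longleftrightarrow> path_map G r \<and> plen r = 1 \<and> pmap r 0 = pmap r 1"

inductive elem_step :: "'a pair_pre_digraph \<Rightarrow> 'a dpath \<Rightarrow> 'a dpath \<Rightarrow> bool"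
  for G :: "'a pair_pre_digraph" where
  cancel: "elem_step G (\<gamma>1 \<star> \<gamma> \<star> pinverse \<gamma> \<star> \<gamma>2) (\<gamma>1 \<star> \<gamma>2)"
    if "path_map G \<gamma>1" "path_map G \<gamma>" "path_map G \<gamma>2"
       "ptarget \<gamma>1 = psource \<gamma>" "psource \<gamma> = psource \<gamma>2"
| trivial: "elem_step G (\<gamma>1 \<star> r \<star> \<gamma>2) (\<gamma>1 \<star> \<gamma>2)"
    if "path_map G \<gamma>1" "trivial_arrow G r" "path_map G \<gamma>2"
       "ptarget \<gamma>1 = psource r" "ptarget r = psource \<gamma>2"

text \<open>
  \<open>elem_step G\<close> only relates path maps on \<open>G\<close>, so on path maps the equivalence closure
  over the whole type is the equivalence relation generated there.
\<close>

definition elem_equiv :: "'a pair_pre_digraph \<Rightarrow> 'a dpath \<Rightarrow> 'a dpath \<Rightarrow> bool" where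
  "elem_equiv G = equivclp (elem_step G)"

definition one_forms :: "'a pair_pre_digraph \<Rightarrow> ('a \<times> 'a \<Rightarrow> 'k) set" where
  "one_forms G = parcs G \<rightarrow>\<^sub>E UNIV"

definition pairing :: "('a \<times> 'a \<Rightarrow> 'k::field_char_0) \<Rightarrow> 'a dpath \<Rightarrow> nat \<Rightarrow> 'k" where
  "pairing \<omega> \<alpha> t =
     (if pmap \<alpha> (t - 1) = pmap \<alpha> t then 0
      else if (t - 1, t) \<in> parcs (pline \<alpha>) then \<omega> (pmap \<alpha> (t - 1), pmap \<alpha> t)
      else - \<omega> (pmap \<alpha> t, pmap \<alpha> (t - 1)))"

text \<open>Values that do not occur in the sequence would contribute the factor \<open>0! = 1\<close>.\<close>

definition tau :: "nat list \<Rightarrow> nat" where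
  "tau ts = (\<Prod>k\<in>set ts. fact (count_list ts k))"

definition iterated_integral ::
  "'a dpath \<Rightarrow> ('a \<times> 'a \<Rightarrow> 'k::field_char_0) list \<Rightarrow> 'k" where
  "iterated_integral \<alpha> \<omega>s =
     (\<Sum>ts | length ts = length \<omega>s \<and> sorted ts \<and> set ts \<subseteq> {1..plen \<alpha>}.
        (\<Prod>i<length \<omega>s. pairing (\<omega>s ! i) \<alpha> (ts ! i)) / of_nat (tau ts))"

end

theory Submission
  imports Defs
begin

text \<open>
  The iterated integrals of a path, collected into one noncommutative power series in the
  forms, multiply under concatenation. A step contributes the exponential of its
  pairing, because the factor \<open>1 / \<tau>\<close> supplies exactly the factorials of the exponential
  series (\<open>sum_sorted_eq_signature\<close>). So the series of a path is an ordered product of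
  exponentials, its \<open>signature\<close>.

  Equivalent paths have equal integrals: a step and its reverse contribute \<open>exp \<phi>\<close> and
  \<open>exp (- \<phi>)\<close>, whose product is 1, and a constant step contributes \<open>exp 0 = 1\<close>. Deleting
  \<open>\<gamma> \<star> \<gamma>\<^sup>-\<^sup>1\<close> or a constant step therefore does not change the product (\<open>signature_elem_step\<close>).

  Conversely, if \<open>\<alpha>\<close> and \<open>\<beta>\<close> have equal integrals, then the loop \<open>\<gamma> = \<alpha> \<star> \<beta>\<^sup>-\<^sup>1\<close> has signature 1
  on the forms of \<open>G\<close>. Remove constant steps and backtrackings from \<open>\<gamma>\<close> as long as there are any.
  If the result were not constant, its steps would spell a nonempty reduced word in the free
  group on the arrows, and evaluating the signature on the dual forms of the successive
  distinct arrows of this word gives a product of nonzero integers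
  (\<open>signature_reduced_word_neq_0\<close>), a contradiction. This is Magnus' argument that
  \<open>a \<mapsto> exp a\<close> embeds a free group into the units of a power series ring. So \<open>\<gamma>\<close> is equivalent
  to a constant path (\<open>elem_equiv_const_path\<close>), and \<open>\<alpha> \<sim> \<gamma> \<star> \<beta> \<sim> \<beta>\<close>.
\<close>

section \<open>Noncommutative power series and ordered products of exponentials\<close>

text \<open>
  A function \<open>f\<close> on words stands for the noncommutative power series \<open>\<Sum>w. f w \<cdot> w\<close>, and
  \<open>f \<diamondop> g\<close> is the product of such series: a word contributes through all its splittings
  into a prefix and a suffix.
\<close>
definition deconc_prod :: "('w list \<Rightarrow> 'k::comm_ring_1) \<Rightarrow> ('w list \<Rightarrow> 'k) \<Rightarrow> 'w list \<Rightarrow> 'k"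
    (infixl "\<diamondop>" 70) where
  "(f \<diamondop> g) ws = (\<Sum>k\<le>length ws. f (take k ws) * g (drop k ws))"

definition deconc_one :: "'w list \<Rightarrow> 'k::comm_ring_1" where
  "deconc_one ws = (if ws = [] then 1 else 0)"

lemma deconc_prod_Nil [simp]: "(f \<diamondop> g) [] = f [] * g []"
  by (simp add: deconc_prod_def)

text \<open>
  Splitting off the first letter turns the product into a recursion on the word, in which
  the left factor is replaced by its derivative along that letter. Associativity follows by
  induction from this recursion, without reindexing of double sums.
\<close>
lemma deconc_prod_Cons:
  "(f \<diamondop> g) (w # ws) = f [] * g (w # ws) + ((\<lambda>us. f (w # us)) \<diamondop> g) ws"
  by (simp add: deconc_prod_def sum.atMost_Suc_shift del: sum.atMost_Suc)

lemma deconc_one_left [simp]: "deconc_one \<diamondop> f = f"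
proof
  fix ws
  have z: "((\<lambda>us. deconc_one (w # us)) \<diamondop> f) vs = 0" for w vs
    by (simp add: deconc_prod_def deconc_one_def)
  show "(deconc_one \<diamondop> f) ws = f ws"
    by (cases ws) (simp_all add: deconc_prod_Cons z, simp_all add: deconc_one_def)
qed

lemma deconc_prod_assoc: "(f \<diamondop> g) \<diamondop> h = f \<diamondop> (g \<diamondop> h)"
proof
  fix ws
  have add: "((\<lambda>us. f1 us + f2 us) \<diamondop> h) vs = (f1 \<diamondop> h) vs + (f2 \<diamondop> h) vs" for f1 f2 vs
    by (simp add: deconc_prod_def algebra_simps sum.distrib)
  have scale: "((\<lambda>us. c * f1 us) \<diamondop> h) vs = c * (f1 \<diamondop> h) vs" for c f1 vs
    by (simp add: deconc_prod_def algebra_simps sum_distrib_left)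
  show "((f \<diamondop> g) \<diamondop> h) ws = (f \<diamondop> (g \<diamondop> h)) ws"
    by (induction ws arbitrary: f g) (simp_all add: deconc_prod_Cons add scale algebra_simps)
qed

text \<open>
  If \<open>\<phi>\<close> is read as the linear combination \<open>\<Sum>w. \<phi> w \<cdot> w\<close> of letters, this is the series
  \<open>exp \<phi>\<close>.
\<close>
definition exp_series :: "('w \<Rightarrow> 'k::field_char_0) \<Rightarrow> 'w list \<Rightarrow> 'k" where
  "exp_series \<phi> ws = (\<Prod>w\<leftarrow>ws. \<phi> w) / fact (length ws)"

lemma exp_series_Nil [simp]: "exp_series \<phi> [] = 1"
  by (simp add: exp_series_def)

lemma exp_series_zero: "exp_series (\<lambda>_. 0) = deconc_one"
proof
  show "exp_series (\<lambda>_. 0) ws = deconc_one ws" for ws :: "'a list"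
    by (cases ws) (simp_all add: exp_series_def deconc_one_def)
qed

text \<open>
  The \<open>k\<close>-th splitting of a word of length \<open>n\<close> carries the coefficient
  \<open>(-1) ^ (n - k) / (k! (n - k)!)\<close>, so the product is the binomial expansion of \<open>(1 - 1) ^ n / n!\<close>.
\<close>
lemma exp_series_uminus: "exp_series \<phi> \<diamondop> exp_series (\<lambda>w. - \<phi> w) = deconc_one"
proof
  fix ws
  let ?n = "length ws" and ?P = "\<Prod>w\<leftarrow>ws. \<phi> w"
  have neg: "(\<Prod>w\<leftarrow>us. - \<phi> w) = (- 1) ^ length us * (\<Prod>w\<leftarrow>us. \<phi> w)" for us
    by (induction us) auto
  have "(exp_series \<phi> \<diamondop> exp_series (\<lambda>w. - \<phi> w)) ws =
      (\<Sum>k\<le>?n. ?P / fact ?n * (of_nat (?n choose k) * 1 ^ k * (- 1) ^ (?n - k)))"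
    unfolding deconc_prod_def
  proof (rule sum.cong)
    fix k assume "k \<in> {..?n}"
    then have k: "k \<le> ?n" by simp
    have split: "(\<Prod>w\<leftarrow>take k ws. \<phi> w) * (\<Prod>w\<leftarrow>drop k ws. \<phi> w) = ?P"
      by (metis append_take_drop_id map_append prod_list.append)
    show "exp_series \<phi> (take k ws) * exp_series (\<lambda>w. - \<phi> w) (drop k ws) =
        ?P / fact ?n * (of_nat (?n choose k) * 1 ^ k * (- 1) ^ (?n - k))"
      using k by (simp add: exp_series_def neg binomial_fact flip: split)
  qed simp
  also have "\<dots> = ?P / fact ?n * (1 + (- 1)) ^ ?n"
    by (simp only: binomial_ring sum_distrib_left)
  also have "\<dots> = deconc_one ws"
    by (auto simp: deconc_one_def power_0_left)
  finally show "(exp_series \<phi> \<diamondop> exp_series (\<lambda>w. - \<phi> w)) ws = deconc_one ws" .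
qed

text \<open>
  The ordered product \<open>exp \<phi>\<^sub>1 \<cdots> exp \<phi>\<^sub>n\<close>. For the steps of a path it is the series whose
  coefficients are the iterated integrals of the path.
\<close>
definition signature :: "('w \<Rightarrow> 'k::field_char_0) list \<Rightarrow> 'w list \<Rightarrow> 'k" where
  "signature \<phi>s = foldr (\<lambda>\<phi> f. exp_series \<phi> \<diamondop> f) \<phi>s deconc_one"

lemma signature_Nil [simp]: "signature [] = deconc_one"
  and signature_Cons: "signature (\<phi> # \<phi>s) = exp_series \<phi> \<diamondop> signature \<phi>s"
  by (simp_all add: signature_def)

lemma signature_empty_word [simp]: "signature \<phi>s [] = 1"
  by (induction \<phi>s) (simp_all add: signature_Cons deconc_one_def)

lemma signature_append: "signature (\<phi>s @ \<psi>s) = signature \<phi>s \<diamondop> signature \<psi>s"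
  by (induction \<phi>s) (simp_all add: signature_Cons deconc_prod_assoc)

lemma signature_inverse:
  "signature (\<phi>s @ rev (map (\<lambda>\<phi> w. - \<phi> w) \<phi>s)) = deconc_one"
proof (induction \<phi>s)
  case (Cons \<phi> \<phi>s)
  have "signature ((\<phi> # \<phi>s) @ rev (map (\<lambda>\<phi> w. - \<phi> w) (\<phi> # \<phi>s))) =
      exp_series \<phi> \<diamondop> (signature (\<phi>s @ rev (map (\<lambda>\<phi> w. - \<phi> w) \<phi>s)) \<diamondop> signature [\<lambda>w. - \<phi> w])"
    by (simp add: signature_Cons signature_append deconc_prod_assoc)
  also have "\<dots> = deconc_one"
    using exp_series_uminus[of \<phi>]
    by (simp only: Cons.IH deconc_one_left signature_Cons signature_Nil flip: deconc_prod_assoc)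
  finally show ?case .
qed simp

lemma tau_replicate_append:
  assumes "m \<notin> set ts"
  shows "tau (replicate k m @ ts) = fact k * tau ts"
proof (cases k)
  case (Suc j)
  have cnt: "count_list (replicate k m) i = (if i = m then k else 0)" for i
    by (induction k) auto
  have "set (replicate k m @ ts) = insert m (set ts)" using Suc by auto
  then have "tau (replicate k m @ ts) =
      (\<Prod>i\<in>insert m (set ts). fact (count_list (replicate k m @ ts) i))"
    by (simp only: tau_def)
  also have "\<dots> = fact k * (\<Prod>i\<in>set ts. fact (count_list ts i))"
    using assms by (auto simp: cnt intro!: prod.cong)
  finally show ?thesis by (simp add: tau_def)
qed simp

lemma prod_nth_eq_prod_list:
  "(\<Prod>i<length ws. f (ws ! i)) = (\<Prod>w\<leftarrow>ws. f w)"
  by (induction ws) (simp_all add: prod.lessThan_Suc_shift del: prod.lessThan_Suc)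

lemma prod_lessThan_add:
  fixes n :: nat
  shows "(\<Prod>i<n + m. f i) = (\<Prod>i<n. f i) * (\<Prod>i<m. f (n + i))"
  by (induction m) (simp_all add: mult.assoc)

text \<open>
  Expanding \<open>exp \<phi>\<^sub>m \<cdots> exp \<phi>\<^sub>n\<close> means choosing how many letters of the word are taken from
  each factor, and such a choice is the same as a weakly increasing sequence of indices; the
  factorials of the exponential series are the multiplicity factors of that sequence. The
  induction splits off the first factor, that is, the initial block of entries equal to \<open>m\<close>.
\<close>
lemma sum_sorted_eq_signature:
  fixes \<phi> :: "nat \<Rightarrow> 'w \<Rightarrow> 'k::field_char_0"
  shows "(\<Sum>ts | length ts = length ws \<and> sorted ts \<and> set ts \<subseteq> {m..n}.
      (\<Prod>i<length ws. \<phi> (ts ! i) (ws ! i)) / of_nat (tau ts)) = signature (map \<phi> [m..<Suc n]) ws"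
proof (induction "Suc n - m" arbitrary: m ws)
  case 0
  then have "{ts. length ts = length ws \<and> sorted ts \<and> set ts \<subseteq> {m..n}} = (if ws = [] then {[]} else {})"
    by auto
  with 0 show ?case by (simp add: deconc_one_def tau_def)
next
  case (Suc d)
  define T where "T m r = {ts. length ts = r \<and> sorted ts \<and> set ts \<subseteq> {m..n}}" for m r
  define W where "W ws ts = (\<Prod>i<length ws. \<phi> (ts ! i) (ws ! i)) / of_nat (tau ts)" for ws ts
  have fin: "finite (T m r)" for m r
    unfolding T_def by (rule finite_subset[OF _ finite_lists_length_eq[of "{m..n}" r]]) auto
  have m: "[m..<Suc n] = m # [Suc m..<Suc n]" "m \<le> n"
    using Suc.hyps(2) by (simp_all add: upt_rec)
  have IH: "(\<Sum>ts\<in>T (Suc m) (length us). W us ts) = signature (map \<phi> [Suc m..<Suc n]) us" for us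
    using Suc.hyps(1)[of "Suc m" us] Suc.hyps(2) by (simp add: T_def W_def)
  have factor: "W ws (replicate k m @ ts) = exp_series (\<phi> m) (take k ws) * W (drop k ws) ts"
    if k: "k \<le> length ws" and ts: "ts \<in> T (Suc m) (length ws - k)" for k ts
  proof -
    have "m \<notin> set ts" using ts by (auto simp: T_def)
    have "(\<Prod>i<length ws. \<phi> ((replicate k m @ ts) ! i) (ws ! i)) =
        (\<Prod>i<k + (length ws - k). \<phi> ((replicate k m @ ts) ! i) (ws ! i))"
      using k by simp
    also have "\<dots> = (\<Prod>i<k. \<phi> m (take k ws ! i)) * (\<Prod>i<length ws - k. \<phi> (ts ! i) (drop k ws ! i))"
      unfolding prod_lessThan_add using k by (simp add: nth_append)
    also have "(\<Prod>i<k. \<phi> m (take k ws ! i)) = (\<Prod>w\<leftarrow>take k ws. \<phi> m w)"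
      using prod_nth_eq_prod_list[of "\<phi> m" "take k ws"] k by simp
    finally have num: "(\<Prod>i<length ws. \<phi> ((replicate k m @ ts) ! i) (ws ! i)) =
        (\<Prod>w\<leftarrow>take k ws. \<phi> m w) * (\<Prod>i<length (drop k ws). \<phi> (ts ! i) (drop k ws ! i))"
      by (simp only: length_drop)
    have "length (take k ws) = k" using k by simp
    then show ?thesis
      unfolding W_def exp_series_def num tau_replicate_append[OF \<open>m \<notin> set ts\<close>] by simp
  qed
  \<comment> \<open>A sorted sequence is the number \<open>k\<close> of its entries \<open>m\<close> together with the remaining sequence.\<close>
  have "(\<Sum>ts\<in>T m (length ws). W ws ts) =
      (\<Sum>(k, ts)\<in>(SIGMA k:{..length ws}. T (Suc m) (length ws - k)). W ws (replicate k m @ ts))"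
  proof (rule sum.reindex_bij_witness[where i = "\<lambda>(k, ts). replicate k m @ ts"
        and j = "\<lambda>ts. (length (takeWhile (\<lambda>t. t = m) ts), dropWhile (\<lambda>t. t = m) ts)"])
    fix ts assume ts: "ts \<in> T m (length ws)"
    have "replicate (length (takeWhile (\<lambda>t. t = m) ts)) m = takeWhile (\<lambda>t. t = m) ts"
      by (rule replicate_eqI[symmetric]) (auto dest: set_takeWhileD)
    then have rep: "replicate (length (takeWhile (\<lambda>t. t = m) ts)) m @ dropWhile (\<lambda>t. t = m) ts = ts"
      by simp
    then show "(case (length (takeWhile (\<lambda>t. t = m) ts), dropWhile (\<lambda>t. t = m) ts) of
        (k, ts) \<Rightarrow> replicate k m @ ts) = ts" by simp
    show "(case (length (takeWhile (\<lambda>t. t = m) ts), dropWhile (\<lambda>t. t = m) ts) of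
        (k, ts) \<Rightarrow> W ws (replicate k m @ ts)) = W ws ts" using rep by simp
    have len: "length (takeWhile (\<lambda>t. t = m) ts) \<le> length ws"
      "length (dropWhile (\<lambda>t. t = m) ts) = length ws - length (takeWhile (\<lambda>t. t = m) ts)"
      using ts length_takeWhile_le[of "\<lambda>t. t = m" ts] by (auto simp: T_def dropWhile_eq_drop)
    have sorted: "sorted (dropWhile (\<lambda>t. t = m) ts)"
      using ts by (auto simp: T_def sorted_dropWhile)
    have sub: "set (dropWhile (\<lambda>t. t = m) ts) \<subseteq> {m..n}"
      using ts by (auto simp: T_def dest: set_dropWhileD)
    have "set (dropWhile (\<lambda>t. t = m) ts) \<subseteq> {Suc m..n}"
    proof (cases "dropWhile (\<lambda>t. t = m) ts")
      case (Cons t us)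
      then have "t \<noteq> m" using hd_dropWhile[of "\<lambda>t. t = m" ts] by simp
      with sub sorted show ?thesis unfolding Cons by fastforce
    next
      case Nil
      show ?thesis unfolding Nil by simp
    qed
    with len sorted show "(length (takeWhile (\<lambda>t. t = m) ts), dropWhile (\<lambda>t. t = m) ts)
        \<in> (SIGMA k:{..length ws}. T (Suc m) (length ws - k))"
      by (auto simp: T_def)
  next
    fix p assume "p \<in> (SIGMA k:{..length ws}. T (Suc m) (length ws - k))"
    then obtain k ts where p: "p = (k, ts)" "k \<le> length ws" "ts \<in> T (Suc m) (length ws - k)"
      by auto
    then have "\<forall>t\<in>set ts. t \<noteq> m" by (auto simp: T_def)
    then have none: "takeWhile (\<lambda>t. t = m) ts = []" "dropWhile (\<lambda>t. t = m) ts = ts"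
      by (cases ts; simp)+
    show "(\<lambda>ts. (length (takeWhile (\<lambda>t. t = m) ts), dropWhile (\<lambda>t. t = m) ts))
        (case p of (k, ts) \<Rightarrow> replicate k m @ ts) = p"
      using none by (simp add: p takeWhile_append dropWhile_append)
    show "(case p of (k, ts) \<Rightarrow> replicate k m @ ts) \<in> T m (length ws)"
      using p m(2) by (auto simp: T_def sorted_append)
  qed
  also have "\<dots> = (\<Sum>k\<le>length ws. \<Sum>ts\<in>T (Suc m) (length ws - k). W ws (replicate k m @ ts))"
    by (subst sum.Sigma) (auto simp: fin)
  also have "\<dots> = (\<Sum>k\<le>length ws. exp_series (\<phi> m) (take k ws) *
      (\<Sum>ts\<in>T (Suc m) (length (drop k ws)). W (drop k ws) ts))"
    by (intro sum.cong) (simp_all add: factor sum_distrib_left)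
  also have "\<dots> = signature (map \<phi> [m..<Suc n]) ws"
    unfolding IH m(1) by (simp add: signature_Cons deconc_prod_def)
  finally show ?case by (simp add: T_def W_def)
qed

section \<open>Reduced words have nontrivial signature\<close>

definition letter_functional :: "'k \<times> 'b \<Rightarrow> ('b \<Rightarrow> 'k::field_char_0) \<Rightarrow> 'k" where
  "letter_functional = (\<lambda>(e, a) \<omega>. e * \<omega> a)"

text \<open>
  A letter of a free group is a generator \<open>a\<close> with an exponent \<open>e = 1\<close> or \<open>e = -1\<close>; here
  \<open>e\<close> ranges over the nonzero scalars. Equal neighbouring generators must have equal exponents,
  so no two neighbours cancel.
\<close>
definition reduced_word :: "('k::field_char_0 \<times> 'b) list \<Rightarrow> bool" where
  "reduced_word l \<longleftrightarrow> (\<forall>(e, a)\<in>set l. e \<noteq> 0) \<and>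
     successively (\<lambda>(e, a) (e', a'). a = a' \<longrightarrow> e = e') l"

text \<open>
  The series \<open>exp (e a)\<close> only contains powers of \<open>a\<close>. A word without equal neighbours
  is a power of \<open>a\<close> only if it is empty or \<open>a\<close> itself, so only the linear part
  of the exponential is seen. Here \<open>\<chi> c\<close> plays the part of the form that is dual to the
  generator \<open>c\<close>.
\<close>
lemma exp_series_indicator:
  assumes "\<And>c. c \<in> set us \<Longrightarrow> \<chi> c a = (if a = c then 1 else 0)"
    and "distinct_adj us"
  shows "exp_series (letter_functional (e, a)) (map \<chi> us) =
    (if us = [] then 1 else if us = [a] then e else 0)"
proof -
  consider "us = []" | c where "us = [c]" | c d vs where "us = c # d # vs"
    by (metis list.exhaust)
  then show ?thesis
    using assms by cases (auto simp: exp_series_def letter_functional_def)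
qed

text \<open>
  The first letter of \<open>l\<close> is either skipped or consumes the first letter of \<open>us\<close>.
\<close>
lemma signature_indicator_Cons:
  assumes "\<And>c. c \<in> set us \<Longrightarrow> \<chi> c a = (if a = c then 1 else 0)"
    and "distinct_adj us"
  shows "signature (map letter_functional ((e, a) # l)) (map \<chi> us) =
    signature (map letter_functional l) (map \<chi> us) +
    (if us \<noteq> [] \<and> hd us = a then e * signature (map letter_functional l) (map \<chi> (tl us)) else 0)"
proof (cases us)
  case (Cons c vs)
  have pre: "exp_series (letter_functional (e, a)) (map \<chi> (take k us)) =
     (if take k us = [] then 1 else if take k us = [a] then e else 0)" for k
  proof (rule exp_series_indicator)
    show "distinct_adj (take k us)"
      using assms(2) append_take_drop_id[of k us] by (metis distinct_adj_appendD1)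
  qed (use assms(1) in \<open>auto dest: in_set_takeD\<close>)
  have "signature (map letter_functional ((e, a) # l)) (map \<chi> us) =
     (\<Sum>k\<le>length us. (if take k us = [] then 1 else if take k us = [a] then e else 0) *
        signature (map letter_functional l) (map \<chi> (drop k us)))"
    by (simp add: signature_Cons deconc_prod_def take_map drop_map pre)
  also have "\<dots> = signature (map letter_functional l) (map \<chi> us) +
     (\<Sum>k\<le>length vs. (if k = 0 then (if c = a then e * signature (map letter_functional l) (map \<chi> vs) else 0) else 0))"
    unfolding Cons list.size(4) add_0_right add_Suc_right sum.atMost_Suc_shift
    by (intro arg_cong2[where f = "(+)"] sum.cong refl) auto
  also have "\<dots> = signature (map letter_functional l) (map \<chi> us) +
     (if c = a then e * signature (map letter_functional l) (map \<chi> vs) else 0)"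
    by simp
  finally show ?thesis using Cons by simp
qed (simp add: signature_Cons)

text \<open>
  Every run of equal generators in \<open>l\<close> can contribute at most one letter to \<open>us\<close>, because
  neighbours in \<open>us\<close> differ. So \<open>us\<close> must not have more letters than \<open>l\<close> has runs, and if the
  numbers agree then every run is used and the first letters coincide. Both bounds are proved
  together since the induction switches between them when a letter is consumed.
\<close>
lemma signature_indicator_eq_0:
  assumes "\<And>a c. a \<in> A \<Longrightarrow> c \<in> A \<Longrightarrow> \<chi> c a = (if a = c then 1 else 0)"
    and "snd ` set l \<subseteq> A" "set us \<subseteq> A" "distinct_adj us" "us \<noteq> []"
    and "length us \<ge> length (remdups_adj (map snd l))"
    and "length us > length (remdups_adj (map snd l)) \<or> hd us \<noteq> hd (map snd l)"
  shows "signature (map letter_functional l) (map \<chi> us) = 0"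
  using assms(2-)
proof (induction l arbitrary: us)
  case Nil
  then show ?case by (simp add: deconc_one_def)
next
  case (Cons p l)
  obtain e a where p: "p = (e, a)" by force
  obtain c vs where us: "us = c # vs" using Cons.prems by (cases us) auto
  have rec: "signature (map letter_functional (p # l)) (map \<chi> us) =
    signature (map letter_functional l) (map \<chi> us) +
    (if us \<noteq> [] \<and> hd us = a then e * signature (map letter_functional l) (map \<chi> (tl us)) else 0)"
    unfolding p using Cons.prems assms(1) p by (intro signature_indicator_Cons) auto
  let ?R = "remdups_adj (map snd l)"
  have rem: "remdups_adj (map snd (p # l)) = (if l \<noteq> [] \<and> hd (map snd l) = a then ?R else a # ?R)"
    using p by (cases l) auto
  have sub: "snd ` set l \<subseteq> A" "set us \<subseteq> A" "set vs \<subseteq> A" "distinct_adj us" "distinct_adj vs"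
    using Cons.prems(1-3) us by (auto simp: distinct_adj_Cons)
  have len: "length us \<ge> length ?R" "length us > length ?R \<or> hd us \<noteq> hd (map snd l)"
    using Cons.prems(5,6) unfolding rem using p by (auto split: if_splits)
  have 1: "signature (map letter_functional l) (map \<chi> us) = 0"
    using Cons.IH[OF sub(1,2,4) Cons.prems(4) len] .
  have 2: "signature (map letter_functional l) (map \<chi> vs) = 0" if "c = a"
  proof -
    have vs: "length vs \<ge> length (remdups_adj (map snd (p # l)))"
      using Cons.prems(6) us p that by simp
    then have "vs \<noteq> []" by (cases vs) simp_all
    moreover from this have "hd vs \<noteq> a" using sub(4) us that by (auto simp: distinct_adj_Cons)
    ultimately show ?thesis
      using vs unfolding rem by (intro Cons.IH sub) (auto split: if_splits)
  qed
  show ?case unfolding rec using 1 2 us by auto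
qed

text \<open>
  This is the argument behind the faithfulness of the Magnus representation of a free group.
  Take the word that lists the runs of \<open>l\<close>. Each run has to contribute exactly its own letter, a
  run of \<open>m\<close> letters \<open>e a\<close> contributes \<open>m e\<close>, and the coefficient is the product of these
  numbers, which is nonzero in characteristic 0.
\<close>
lemma signature_reduced_word_neq_0:
  assumes "\<And>a c. a \<in> A \<Longrightarrow> c \<in> A \<Longrightarrow> \<chi> c a = (if a = c then 1 else 0)"
    and "snd ` set l \<subseteq> A" "reduced_word l" "l \<noteq> []"
  shows "signature (map letter_functional l) (map \<chi> (remdups_adj (map snd l))) \<noteq> 0"
proof -
  let ?S = "\<lambda>l us. signature (map letter_functional l) (map \<chi> us)"
  \<comment> \<open>The induction needs the coefficient of the word without the first run as well: it is the product
      over the remaining runs, and \<open>m\<close> is the length of the first run.\<close>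
  have "\<exists>m>0. ?S l (remdups_adj (map snd l)) = of_nat m * fst (hd l) * ?S l (tl (remdups_adj (map snd l)))
      \<and> ?S l (tl (remdups_adj (map snd l))) \<noteq> 0"
    using assms(2-)
  proof (induction l)
    case (Cons p l)
    obtain e a where p: "p = (e, a)" by force
    have e: "e \<noteq> 0" using Cons.prems p by (auto simp: reduced_word_def)
    have red: "reduced_word l" using Cons.prems by (cases l) (auto simp: reduced_word_def)
    have rec: "?S (p # l) us = ?S l us + (if us \<noteq> [] \<and> hd us = a then e * ?S l (tl us) else 0)"
      if "set us \<subseteq> A" "distinct_adj us" for us
      unfolding p using Cons.prems assms(1) p that by (intro signature_indicator_Cons) auto
    show ?case
    proof (cases l)
      case Nil
      then show ?thesis using rec[of "[a]"] rec[of "[]"] Cons.prems p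
        by (intro exI[of _ 1]) (simp add: deconc_one_def)
    next
      case (Cons q l')
      obtain e' a' where q: "q = (e', a')" by force
      define bs where "bs = remdups_adj (map snd l)"
      have A: "set bs \<subseteq> A" "a \<in> A" using Cons.prems p by (auto simp: bs_def)
      have bs: "bs = a' # tl bs" "distinct_adj bs"
        using Cons q unfolding bs_def distinct_adj_def[symmetric]
        by (simp add: remdups_adj_Cons split: list.splits) simp
      obtain m where m: "m > 0" "?S l bs = of_nat m * e' * ?S l (tl bs)" "?S l (tl bs) \<noteq> 0"
        using Cons.IH Cons.prems red Cons q by (auto simp: bs_def)
      show ?thesis
      proof (cases "a = a'")
        case True
        then have e': "e' = e" using Cons.prems p q Cons by (auto simp: reduced_word_def)
        have eq: "remdups_adj (map snd (p # l)) = bs" using True p q Cons by (simp add: bs_def)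
        obtain cs where cs: "bs = a # cs" using bs(1) True by blast
        have tl: "set (tl bs) \<subseteq> A" "distinct_adj (tl bs)" "tl bs = [] \<or> hd (tl bs) \<noteq> a"
          using A bs(2) unfolding cs by (auto simp: distinct_adj_Cons)
        have "?S (p # l) bs = ?S l bs + e * ?S l (tl bs)"
          using rec[OF A(1) bs(2)] cs by simp
        also have "\<dots> = of_nat (Suc m) * e * ?S l (tl bs)"
          unfolding m(2) e' by (simp add: algebra_simps)
        finally have "?S (p # l) bs = of_nat (Suc m) * e * ?S l (tl bs)" .
        moreover have "?S (p # l) (tl bs) = ?S l (tl bs)"
          using rec[OF tl(1,2)] tl(3) by auto
        ultimately show ?thesis unfolding eq using m(3) p by (intro exI[of _ "Suc m"]) simp
      next
        case False
        have eq: "remdups_adj (map snd (p # l)) = a # bs" using False p q Cons by (simp add: bs_def)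
        obtain cs where cs: "bs = a' # cs" using bs(1) by blast
        have ab: "set (a # bs) \<subseteq> A" "distinct_adj (a # bs)"
          using A bs(2) False unfolding cs by auto
        have "?S l (a # bs) = 0"
          using Cons.prems(1) by (intro signature_indicator_eq_0[OF assms(1) _ ab]) (auto simp: bs_def)
        then have "?S (p # l) (a # bs) = e * ?S l bs"
          using rec[OF ab] by simp
        moreover have "?S (p # l) bs = ?S l bs"
          using rec[OF A(1) bs(2)] cs False by simp
        moreover have "?S l bs \<noteq> 0" using m e red q Cons by (simp add: reduced_word_def)
        ultimately show ?thesis unfolding eq using p by (intro exI[of _ 1]) simp
      qed
    qed
  qed simp
  moreover have "fst (hd l) \<noteq> 0" using assms(3,4) by (cases l) (auto simp: reduced_word_def)
  ultimately show ?thesis by auto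
qed

section \<open>A normal form for path maps\<close>

definition forward :: "'a dpath \<Rightarrow> nat \<Rightarrow> bool" where
  "forward \<alpha> i \<longleftrightarrow> (i, Suc i) \<in> parcs (pline \<alpha>)"

text \<open>
  A normal form for path maps: a line digraph of length \<open>n\<close> is the same as a choice of
  orientations \<open>F\<close>, and only the values of \<open>F\<close> below \<open>n\<close> and of \<open>p\<close> up to \<open>n\<close> matter. Concatenation
  and inversion act on \<open>F\<close> and \<open>p\<close> by explicit formulas, so identities between path maps reduce
  to equalities of two functions on initial segments.
\<close>
definition make_path :: "nat \<Rightarrow> (nat \<Rightarrow> bool) \<Rightarrow> (nat \<Rightarrow> 'a) \<Rightarrow> 'a dpath" where
  "make_path n F p =
     \<lparr> plen = n,
       pline = \<lparr> pverts = {0..n},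
                 parcs = {(i, Suc i) | i. i < n \<and> F i} \<union> {(Suc i, i) | i. i < n \<and> \<not> F i} \<rparr>,
       pmap = (\<lambda>i\<in>{0..n}. p i) \<rparr>"

lemma make_path_simps [simp]:
  "plen (make_path n F p) = n"
  "i \<le> n \<Longrightarrow> pmap (make_path n F p) i = p i"
  "i < n \<Longrightarrow> forward (make_path n F p) i = F i"
  "psource (make_path n F p) = p 0"
  "ptarget (make_path n F p) = p n"
  by (auto simp: make_path_def forward_def psource_def ptarget_def)

lemma make_path_cong:
  assumes "n = m" "\<And>i. i < n \<Longrightarrow> F i = F' i" "\<And>i. i \<le> n \<Longrightarrow> p i = p' i"
  shows "make_path n F p = make_path m F' p'"
  using assms by (auto simp: make_path_def)

lemma line_digraph_arc_iff:
  assumes "line_digraph n I"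
  shows "(i, j) \<in> parcs I \<longleftrightarrow>
    (i < n \<and> j = Suc i \<and> (i, Suc i) \<in> parcs I) \<or> (j < n \<and> i = Suc j \<and> (j, Suc j) \<notin> parcs I)"
proof -
  have adj: "(i < n \<and> j = Suc i) \<or> (j < n \<and> i = Suc j)" if "(i, j) \<in> parcs I"
  proof -
    have "(i, j) \<in> (\<Union>k<n. {(k, Suc k), (Suc k, k)})"
      using assms that by (simp only: line_digraph_def) (rule subsetD, simp_all)
    then show ?thesis by auto
  qed
  have excl: "(k, Suc k) \<in> parcs I \<longleftrightarrow> (Suc k, k) \<notin> parcs I" if "k < n" for k
    using assms that by (simp add: line_digraph_def)
  consider "i < n" "j = Suc i" | "j < n" "i = Suc j"
    | "\<not> (i < n \<and> j = Suc i)" "\<not> (j < n \<and> i = Suc j)" by blast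
  then show ?thesis
  proof cases
    case 1
    then show ?thesis by simp
  next
    case 2
    then show ?thesis using excl[OF 2(1)] by simp
  next
    case 3
    then show ?thesis using adj by blast
  qed
qed

lemma path_map_make_path_iff:
  "path_map G (make_path n F p) \<longleftrightarrow>
     (\<forall>i\<le>n. p i \<in> pverts G) \<and>
     (\<forall>i<n. p i = p (Suc i) \<or>
        (if F i then (p i, p (Suc i)) \<in> parcs G else (p (Suc i), p i) \<in> parcs G))"
proof -
  have "line_digraph n (pline (make_path n F p))"
    by (auto simp: line_digraph_def make_path_def)
  moreover have "digraph_map (pline (make_path n F p)) G (pmap (make_path n F p)) \<longleftrightarrow>
     (\<forall>i\<le>n. p i \<in> pverts G) \<and>
     (\<forall>i<n. p i = p (Suc i) \<or>
        (if F i then (p i, p (Suc i)) \<in> parcs G else (p (Suc i), p i) \<in> parcs G))"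
  proof -
    have "pmap (make_path n F p) \<in> pverts (pline (make_path n F p)) \<rightarrow>\<^sub>E pverts G \<longleftrightarrow>
        (\<forall>i\<le>n. p i \<in> pverts G)"
      by (simp add: make_path_def PiE_def Pi_def)
    moreover have "(\<forall>(u, v) \<in> parcs (pline (make_path n F p)). Q u v) \<longleftrightarrow>
        (\<forall>i<n. if F i then Q i (Suc i) else Q (Suc i) i)" for Q
      by (auto simp: make_path_def)
    ultimately show ?thesis
      unfolding digraph_map_def by (simp add: if_distrib eq_commute cong: if_cong)
  qed
  ultimately show ?thesis by (simp add: path_map_def)
qed

lemma path_map_eq_make_path:
  assumes "path_map G \<alpha>"
  shows "\<alpha> = make_path (plen \<alpha>) (forward \<alpha>) (pmap \<alpha>)"
proof (cases \<alpha>)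
  case (fields n I p)
  have I: "line_digraph n I" and p: "p \<in> {0..n} \<rightarrow>\<^sub>E pverts G"
    using assms fields by (auto simp: path_map_def digraph_map_def line_digraph_def)
  have arcs: "{(i, Suc i) | i. i < n \<and> (i, Suc i) \<in> parcs I} \<union>
      {(Suc i, i) | i. i < n \<and> (i, Suc i) \<notin> parcs I} = parcs I" (is "?R = _")
  proof (rule set_eqI)
    fix a
    show "a \<in> ?R \<longleftrightarrow> a \<in> parcs I"
    proof (cases a)
      case (Pair i j)
      show ?thesis
        unfolding Pair line_digraph_arc_iff[OF I, of i j] by simp blast
    qed
  qed
  have "pverts I = {0..n}" using I by (simp add: line_digraph_def)
  then have pline: "\<lparr> pverts = {0..n}, parcs = parcs I \<rparr> = I" by simp
  have "restrict p {0..n} = p" using p by (auto simp: PiE_def extensional_restrict)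
  then show ?thesis
    by (simp only: fields dpath.select_convs make_path_def forward_def arcs pline)
qed

lemma parcs_make_path_iff:
  "(i, j) \<in> parcs (pline (make_path n F p)) \<longleftrightarrow>
     (i < n \<and> j = Suc i \<and> F i) \<or> (j < n \<and> i = Suc j \<and> \<not> F j)"
  by (auto simp: make_path_def)

lemma pconcat_make_path:
  "make_path n F p \<star> make_path m F' p' =
     make_path (n + m) (\<lambda>i. if i < n then F i else F' (i - n)) (\<lambda>i. if i \<le> n then p i else p' (i - n))"
proof -
  have arcs: "parcs (pline (make_path n F p)) \<union>
      {(n + i, n + j) | i j. (i, j) \<in> parcs (pline (make_path m F' p'))} =
     {(i, Suc i) | i. i < n + m \<and> (if i < n then F i else F' (i - n))} \<union>
     {(Suc i, i) | i. i < n + m \<and> \<not> (if i < n then F i else F' (i - n))}"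
    (is "?L = ?R")
  proof -
    have "(i, j) \<in> ?L \<longleftrightarrow> (i, j) \<in> ?R" for i j
    proof (cases "i < n \<or> j < n")
      case True
      then show ?thesis by (auto simp: parcs_make_path_iff)
    next
      case False
      then obtain i' j' where "i = n + i'" "j = n + j'" by (metis le_Suc_ex not_less)
      then show ?thesis by (auto simp: parcs_make_path_iff)
    qed
    then show ?thesis by (simp only: set_eq_iff split_paired_All simp_thms)
  qed
  show ?thesis
    unfolding pconcat_def Let_def make_path_simps arcs
    by (auto simp: make_path_def restrict_def fun_eq_iff)
qed

lemma pinverse_make_path:
  "pinverse (make_path n F p) = make_path n (\<lambda>i. \<not> F (n - Suc i)) (\<lambda>i. p (n - i))"
proof -
  have "i \<le> n \<and> j \<le> n \<and> (n - i, n - j) \<in> parcs (pline (make_path n F p)) \<longleftrightarrow>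
     (i < n \<and> j = Suc i \<and> \<not> F (n - Suc i)) \<or> (j < n \<and> i = Suc j \<and> F (n - Suc j))" for i j
  proof (cases "i \<le> n \<and> j \<le> n")
    case True
    then have "n - j = Suc (n - i) \<longleftrightarrow> i = Suc j" "n - i = Suc (n - j) \<longleftrightarrow> j = Suc i"
      by linarith+
    with True show ?thesis by (auto simp: parcs_make_path_iff)
  qed auto
  then have arcs: "{(i, j). i \<le> n \<and> j \<le> n \<and> (n - i, n - j) \<in> parcs (pline (make_path n F p))} =
     {(i, Suc i) | i. i < n \<and> \<not> F (n - Suc i)} \<union> {(Suc i, i) | i. i < n \<and> \<not> \<not> F (n - Suc i)}"
    by auto
  show ?thesis
    unfolding pinverse_def Let_def make_path_simps arcs by (auto simp: make_path_def)
qed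

lemma path_cases:
  assumes "path_map G \<alpha>"
  obtains n F p where "\<alpha> = make_path n F p"
  by (rule that[OF path_map_eq_make_path[OF assms]])

lemma path_map_pconcat:
  assumes "path_map G \<alpha>" "path_map G \<beta>" "ptarget \<alpha> = psource \<beta>"
  shows "path_map G (\<alpha> \<star> \<beta>)" "plen (\<alpha> \<star> \<beta>) = plen \<alpha> + plen \<beta>"
    "psource (\<alpha> \<star> \<beta>) = psource \<alpha>" "ptarget (\<alpha> \<star> \<beta>) = ptarget \<beta>"
proof -
  obtain n F p m F' p' where eq: "\<alpha> = make_path n F p" "\<beta> = make_path m F' p'"
    using assms path_cases by metis
  have glue: "(if i \<le> n then p i else p' (i - n)) = (if i < n then p i else p' (i - n))" for i
    using assms(3) by (auto simp: eq)
  have "path_map G (make_path (n + m) (\<lambda>i. if i < n then F i else F' (i - n))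
      (\<lambda>i. if i \<le> n then p i else p' (i - n)))"
    unfolding path_map_make_path_iff
  proof (intro conjI allI impI)
    fix i assume "i < n + m"
    then consider "i < n" | j where "i = n + j" "j < m"
      by (metis add_less_cancel_left le_Suc_ex linorder_not_less)
    then show "(if i \<le> n then p i else p' (i - n)) = (if Suc i \<le> n then p (Suc i) else p' (Suc i - n)) \<or>
      (if if i < n then F i else F' (i - n)
       then ((if i \<le> n then p i else p' (i - n)), (if Suc i \<le> n then p (Suc i) else p' (Suc i - n))) \<in> parcs G
       else ((if Suc i \<le> n then p (Suc i) else p' (Suc i - n)), (if i \<le> n then p i else p' (i - n))) \<in> parcs G)"
      using assms(1,2) assms(3)[symmetric]
      by cases (auto simp: eq path_map_make_path_iff Suc_diff_le)
  qed (use assms(1,2) in \<open>auto simp: eq path_map_make_path_iff\<close>)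
  then show "path_map G (\<alpha> \<star> \<beta>)" "plen (\<alpha> \<star> \<beta>) = plen \<alpha> + plen \<beta>"
    "psource (\<alpha> \<star> \<beta>) = psource \<alpha>" "ptarget (\<alpha> \<star> \<beta>) = ptarget \<beta>"
    using assms(3) by (auto simp: eq pconcat_make_path)
qed

lemma path_map_pinverse:
  assumes "path_map G \<alpha>"
  shows "path_map G (pinverse \<alpha>)" "plen (pinverse \<alpha>) = plen \<alpha>"
    "psource (pinverse \<alpha>) = ptarget \<alpha>" "ptarget (pinverse \<alpha>) = psource \<alpha>"
    "pinverse (pinverse \<alpha>) = \<alpha>"
proof -
  obtain n F p where eq: "\<alpha> = make_path n F p" by (rule path_cases[OF assms(1)])
  have "p (n - i) = p (n - Suc i) \<or>
      (if \<not> F (n - Suc i) then (p (n - i), p (n - Suc i)) \<in> parcs G else (p (n - Suc i), p (n - i)) \<in> parcs G)"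
    if "i < n" for i
  proof -
    obtain j where "n - i = Suc j" "n - Suc i = j" "j < n" 
      using \<open>i < n\<close> by (intro that[of "n - Suc i"]) auto
    then show ?thesis using assms unfolding eq path_map_make_path_iff by auto
  qed
  then show "path_map G (pinverse \<alpha>)"
    using assms by (simp add: eq pinverse_make_path path_map_make_path_iff)
  show "plen (pinverse \<alpha>) = plen \<alpha>"
    "psource (pinverse \<alpha>) = ptarget \<alpha>" "ptarget (pinverse \<alpha>) = psource \<alpha>"
    by (auto simp: eq pinverse_make_path)
  show "pinverse (pinverse \<alpha>) = \<alpha>"
    unfolding eq pinverse_make_path by (rule make_path_cong) auto
qed

lemma pconcat_assoc:
  assumes "path_map G \<alpha>" "path_map G \<beta>" "path_map G \<gamma>"
  shows "\<alpha> \<star> \<beta> \<star> \<gamma> = \<alpha> \<star> (\<beta> \<star> \<gamma>)"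
proof -
  obtain n F p m F' p' l F'' p'' where
    eq: "\<alpha> = make_path n F p" "\<beta> = make_path m F' p'" "\<gamma> = make_path l F'' p''"
    using assms path_cases by metis
  show ?thesis
    unfolding eq pconcat_make_path by (rule make_path_cong) auto
qed

definition const_path :: "'a \<Rightarrow> 'a dpath" where
  "const_path x = make_path 0 (\<lambda>_. True) (\<lambda>_. x)"

lemma path_map_const_path: "path_map G (const_path x) \<longleftrightarrow> x \<in> pverts G"
  by (simp add: const_path_def path_map_make_path_iff)

lemma const_path_simps [simp]:
  "plen (const_path x) = 0" "psource (const_path x) = x" "ptarget (const_path x) = x"
  by (simp_all add: const_path_def)

lemma path_map_plen_0:
  assumes "path_map G \<alpha>" "plen \<alpha> = 0"
  shows "\<alpha> = const_path (psource \<alpha>)"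
proof -
  obtain n F p where eq: "\<alpha> = make_path n F p" by (rule path_cases[OF assms(1)])
  show ?thesis using assms(2) unfolding eq const_path_def by (intro make_path_cong) auto
qed

lemma pconcat_const_path:
  assumes "path_map G \<alpha>"
  shows "\<alpha> \<star> const_path (ptarget \<alpha>) = \<alpha>" "const_path (psource \<alpha>) \<star> \<alpha> = \<alpha>"
proof -
  obtain n F p where eq: "\<alpha> = make_path n F p" by (rule path_cases[OF assms(1)])
  show "\<alpha> \<star> const_path (ptarget \<alpha>) = \<alpha>" "const_path (psource \<alpha>) \<star> \<alpha> = \<alpha>"
    unfolding eq const_path_def pconcat_make_path by (rule make_path_cong; auto)+
qed

definition subpath :: "'a dpath \<Rightarrow> nat \<Rightarrow> nat \<Rightarrow> 'a dpath" where
  "subpath \<alpha> i j = make_path (j - i) (\<lambda>k. forward \<alpha> (i + k)) (\<lambda>k. pmap \<alpha> (i + k))"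

lemma subpath_simps [simp]:
  "plen (subpath \<alpha> i j) = j - i"
  "psource (subpath \<alpha> i j) = pmap \<alpha> i"
  "i \<le> j \<Longrightarrow> ptarget (subpath \<alpha> i j) = pmap \<alpha> j"
  "k \<le> j - i \<Longrightarrow> pmap (subpath \<alpha> i j) k = pmap \<alpha> (i + k)"
  by (simp_all add: subpath_def)

lemma path_map_subpath:
  assumes "path_map G \<alpha>" "j \<le> plen \<alpha>" "i \<le> j"
  shows "path_map G (subpath \<alpha> i j)"
proof -
  obtain n F p where eq: "\<alpha> = make_path n F p" by (rule path_cases[OF assms(1)])
  have vert: "p k \<in> pverts G" if "k \<le> n" for k
    using assms(1) that by (auto simp: eq path_map_make_path_iff)
  have arc: "p k = p (Suc k) \<or> (if F k then (p k, p (Suc k)) \<in> parcs G else (p (Suc k), p k) \<in> parcs G)"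
    if "k < n" for k
    using assms(1) that by (auto simp: eq path_map_make_path_iff)
  show ?thesis
    unfolding subpath_def path_map_make_path_iff
  proof (intro conjI allI impI)
    show "pmap \<alpha> (i + k) \<in> pverts G" if "k \<le> j - i" for k
      using vert[of "i + k"] assms(2,3) that by (simp add: eq)
    show "pmap \<alpha> (i + k) = pmap \<alpha> (i + Suc k) \<or>
        (if forward \<alpha> (i + k) then (pmap \<alpha> (i + k), pmap \<alpha> (i + Suc k)) \<in> parcs G
         else (pmap \<alpha> (i + Suc k), pmap \<alpha> (i + k)) \<in> parcs G)" if "k < j - i" for k
    proof -
      have "i + k < n" using assms(2,3) that by (simp add: eq)
      with arc[OF this] show ?thesis by (auto simp: eq)
    qed
  qed
qed

lemma subpath_pconcat:
  assumes "i \<le> j" "j \<le> k"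
  shows "subpath \<alpha> i j \<star> subpath \<alpha> j k = subpath \<alpha> i k"
  unfolding subpath_def pconcat_make_path using assms
  by (intro make_path_cong) (auto simp: add.commute)

lemma subpath_full:
  assumes "path_map G \<alpha>"
  shows "subpath \<alpha> 0 (plen \<alpha>) = \<alpha>"
  by (simp add: subpath_def path_map_eq_make_path[OF assms, symmetric])

text \<open>
  Two consecutive steps that traverse the same arrow back and forth are a path of length 1
  followed by its inverse.
\<close>
lemma subpath_backtrack:
  assumes "pmap \<alpha> (Suc (Suc i)) = pmap \<alpha> i" "forward \<alpha> (Suc i) \<longleftrightarrow> \<not> forward \<alpha> i"
  shows "subpath \<alpha> (Suc i) (Suc (Suc i)) = pinverse (subpath \<alpha> i (Suc i))"
  unfolding subpath_def pinverse_make_path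
proof (rule make_path_cong)
  fix k assume "k \<le> Suc (Suc i) - Suc i"
  then consider "k = 0" | "k = 1" by force
  then show "pmap \<alpha> (Suc i + k) = pmap \<alpha> (i + (Suc i - i - k))"
    using assms(1) by cases auto
qed (use assms in auto)

section \<open>The signature of a path is invariant under elementary equivalence\<close>

definition step_functionals :: "'a dpath \<Rightarrow> (('a \<times> 'a \<Rightarrow> 'k::field_char_0) \<Rightarrow> 'k) list" where
  "step_functionals \<alpha> = map (\<lambda>t \<omega>. pairing \<omega> \<alpha> t) [1..<Suc (plen \<alpha>)]"

lemma iterated_integral_eq_signature:
  "iterated_integral \<alpha> \<omega>s = signature (step_functionals \<alpha>) \<omega>s"
  unfolding iterated_integral_def step_functionals_def
  by (rule sum_sorted_eq_signature)

lemma pairing_Suc_make_path: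
  assumes "i < n"
  shows "pairing \<omega> (make_path n F p) (Suc i) =
    (if p i = p (Suc i) then 0 else if F i then \<omega> (p i, p (Suc i)) else - \<omega> (p (Suc i), p i))"
  using assms by (simp add: pairing_def parcs_make_path_iff)

lemma length_step_functionals [simp]: "length (step_functionals \<alpha>) = plen \<alpha>"
  by (simp add: step_functionals_def)

lemma nth_step_functionals:
  "i < plen \<alpha> \<Longrightarrow> step_functionals \<alpha> ! i = (\<lambda>\<omega>. pairing \<omega> \<alpha> (Suc i))"
  by (simp add: step_functionals_def del: upt_Suc)

lemma step_functionals_pconcat:
  assumes "path_map G \<alpha>" "path_map G \<beta>" "ptarget \<alpha> = psource \<beta>"
  shows "step_functionals (\<alpha> \<star> \<beta>) = step_functionals \<alpha> @ step_functionals \<beta>"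
proof (rule nth_equalityI)
  show "length (step_functionals (\<alpha> \<star> \<beta>)) = length (step_functionals \<alpha> @ step_functionals \<beta>)"
    using path_map_pconcat(2)[OF assms] by simp
  fix i assume "i < length (step_functionals (\<alpha> \<star> \<beta>))"
  then have i: "i < plen \<alpha> + plen \<beta>" using path_map_pconcat(2)[OF assms] by simp
  obtain n F p where a: "\<alpha> = make_path n F p" by (rule path_cases[OF assms(1)])
  obtain m F' p' where b: "\<beta> = make_path m F' p'" by (rule path_cases[OF assms(2)])
  have glue: "p n = p' 0" using assms(3) by (simp add: a b)
  show "step_functionals (\<alpha> \<star> \<beta>) ! i = (step_functionals \<alpha> @ step_functionals \<beta>) ! i"
  proof (cases "i < n")
    case True
    then show ?thesis
      by (simp add: a b pconcat_make_path nth_append nth_step_functionals pairing_Suc_make_path)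
  next
    case False
    then obtain j where j: "i = n + j" by (metis le_Suc_ex not_less)
    then have "j < m" using i by (simp add: a b)
    then show ?thesis using glue
      by (cases j)
        (auto simp: fun_eq_iff j a b pconcat_make_path nth_append nth_step_functionals pairing_Suc_make_path)
  qed
qed

text \<open>
  Running backwards reverses the order of the steps and flips their orientations, and with
  them the signs of the pairings.
\<close>
lemma step_functionals_pinverse:
  assumes "path_map G \<alpha>"
  shows "step_functionals (pinverse \<alpha>) = rev (map (\<lambda>\<phi> \<omega>. - \<phi> \<omega>) (step_functionals \<alpha>))"
proof (rule nth_equalityI)
  show len: "length (step_functionals (pinverse \<alpha>)) =
      length (rev (map (\<lambda>\<phi> \<omega>. - \<phi> \<omega>) (step_functionals \<alpha>)))"
    using path_map_pinverse(2)[OF assms] by simp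
  obtain n F p where a: "\<alpha> = make_path n F p" by (rule path_cases[OF assms(1)])
  fix i assume "i < length (step_functionals (pinverse \<alpha>))"
  then have i: "i < n" by (simp add: a pinverse_make_path)
  then have "n - i = Suc (n - Suc i)" by simp
  with i show "step_functionals (pinverse \<alpha>) ! i =
      rev (map (\<lambda>\<phi> \<omega>. - \<phi> \<omega>) (step_functionals \<alpha>)) ! i"
    by (auto simp: a pinverse_make_path rev_nth nth_step_functionals pairing_Suc_make_path fun_eq_iff)
qed

lemma signature_pconcat:
  assumes "path_map G \<alpha>" "path_map G \<beta>" "ptarget \<alpha> = psource \<beta>"
  shows "signature (step_functionals (\<alpha> \<star> \<beta>)) =
    signature (step_functionals \<alpha>) \<diamondop> signature (step_functionals \<beta>)"
  by (simp add: step_functionals_pconcat[OF assms] signature_append)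

lemma signature_pinverse:
  assumes "path_map G \<alpha>"
  shows "signature (step_functionals \<alpha>) \<diamondop> signature (step_functionals (pinverse \<alpha>)) = deconc_one"
  by (simp add: step_functionals_pinverse[OF assms] signature_inverse flip: signature_append)

lemma signature_trivial_arrow:
  assumes "trivial_arrow G r"
  shows "signature (step_functionals r) = deconc_one"
  using assms
  by (simp add: trivial_arrow_def step_functionals_def pairing_def signature_Cons exp_series_zero)

definition null_loop :: "'a pair_pre_digraph \<Rightarrow> 'a dpath \<Rightarrow> bool" where
  "null_loop G \<delta> \<longleftrightarrow>
     trivial_arrow G \<delta> \<or> (\<exists>\<gamma>. path_map G \<gamma> \<and> \<delta> = \<gamma> \<star> pinverse \<gamma>)"

lemma null_loop:
  assumes "null_loop G \<delta>"
  shows path_map_null_loop: "path_map G \<delta>"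
    and ptarget_null_loop: "ptarget \<delta> = psource \<delta>"
    and signature_null_loop: "signature (step_functionals \<delta>) = deconc_one"
proof -
  have "path_map G \<delta> \<and> ptarget \<delta> = psource \<delta> \<and> signature (step_functionals \<delta>) = deconc_one"
    using assms unfolding null_loop_def
  proof (elim disjE exE conjE)
    assume "trivial_arrow G \<delta>"
    then show ?thesis
      by (simp add: signature_trivial_arrow) (simp add: trivial_arrow_def psource_def ptarget_def)
  next
    fix \<gamma> assume \<gamma>: "path_map G \<gamma>" "\<delta> = \<gamma> \<star> pinverse \<gamma>"
    note inv = path_map_pinverse[OF \<gamma>(1)]
    show ?thesis
      using path_map_pconcat[OF \<gamma>(1) inv(1) inv(3)[symmetric]] inv \<gamma>
      by (simp add: signature_pconcat[OF \<gamma>(1) inv(1) inv(3)[symmetric]] signature_pinverse)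
  qed
  then show "path_map G \<delta>" "ptarget \<delta> = psource \<delta>"
    "signature (step_functionals \<delta>) = deconc_one" by blast+
qed

text \<open>
  Both generating relations delete a loop from the middle of a path. In this form they share
  the proofs below.
\<close>
lemma elem_step_iff:
  "elem_step G \<alpha> \<beta> \<longleftrightarrow>
    (\<exists>\<gamma>1 \<delta> \<gamma>2. path_map G \<gamma>1 \<and> null_loop G \<delta> \<and> path_map G \<gamma>2 \<and>
       ptarget \<gamma>1 = psource \<delta> \<and> psource \<delta> = psource \<gamma>2 \<and>
       \<alpha> = \<gamma>1 \<star> \<delta> \<star> \<gamma>2 \<and> \<beta> = \<gamma>1 \<star> \<gamma>2)" (is "_ \<longleftrightarrow> ?R")
proof
  assume "elem_step G \<alpha> \<beta>"
  then show ?R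
  proof cases
    case (cancel \<gamma>1 \<gamma> \<gamma>2)
    note inv = path_map_pinverse[OF cancel(4)]
    have "psource (\<gamma> \<star> pinverse \<gamma>) = psource \<gamma>"
      using path_map_pconcat(3)[OF cancel(4) inv(1)] inv(3) by simp
    with cancel show ?thesis
      by (intro exI[of _ \<gamma>1] exI[of _ "\<gamma> \<star> pinverse \<gamma>"] exI[of _ \<gamma>2])
        (auto simp: null_loop_def pconcat_assoc[OF cancel(3,4) inv(1)])
  next
    case (trivial \<gamma>1 r \<gamma>2)
    then have "null_loop G r" by (simp add: null_loop_def)
    with trivial ptarget_null_loop[OF this] show ?thesis by metis
  qed
next
  assume ?R
  then obtain \<gamma>1 \<delta> \<gamma>2 where r: "path_map G \<gamma>1" "null_loop G \<delta>" "path_map G \<gamma>2"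
    "ptarget \<gamma>1 = psource \<delta>" "psource \<delta> = psource \<gamma>2" "\<alpha> = \<gamma>1 \<star> \<delta> \<star> \<gamma>2" "\<beta> = \<gamma>1 \<star> \<gamma>2"
    by blast
  from r(2) consider "trivial_arrow G \<delta>" | \<gamma> where "path_map G \<gamma>" "\<delta> = \<gamma> \<star> pinverse \<gamma>"
    unfolding null_loop_def by blast
  then show "elem_step G \<alpha> \<beta>"
  proof cases
    case 1
    then show ?thesis
      unfolding r(6,7) using r ptarget_null_loop[OF r(2)] by (intro elem_step.trivial) simp_all
  next
    case (2 \<gamma>)
    note inv = path_map_pinverse[OF 2(1)]
    have start: "psource \<delta> = psource \<gamma>"
      using path_map_pconcat(3)[OF 2(1) inv(1)] inv(3) 2(2) by simp
    show ?thesis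
      unfolding r(6,7) 2(2) pconcat_assoc[OF r(1) 2(1) inv(1), symmetric]
      using start r 2(1) by (intro elem_step.cancel) simp_all
  qed
qed

lemma elem_stepE:
  assumes "elem_step G \<alpha> \<beta>"
  obtains \<gamma>1 \<delta> \<gamma>2 where "path_map G \<gamma>1" "null_loop G \<delta>" "path_map G \<gamma>2"
    "ptarget \<gamma>1 = psource \<delta>" "psource \<delta> = psource \<gamma>2" "ptarget \<gamma>1 = psource \<gamma>2"
    "path_map G (\<gamma>1 \<star> \<delta>)" "ptarget (\<gamma>1 \<star> \<delta>) = psource \<gamma>2"
    "\<alpha> = \<gamma>1 \<star> \<delta> \<star> \<gamma>2" "\<beta> = \<gamma>1 \<star> \<gamma>2"
proof -
  obtain \<gamma>1 \<delta> \<gamma>2 where r: "path_map G \<gamma>1" "null_loop G \<delta>" "path_map G \<gamma>2"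
    "ptarget \<gamma>1 = psource \<delta>" "psource \<delta> = psource \<gamma>2" "\<alpha> = \<gamma>1 \<star> \<delta> \<star> \<gamma>2" "\<beta> = \<gamma>1 \<star> \<gamma>2"
    using assms unfolding elem_step_iff by blast
  have "path_map G (\<gamma>1 \<star> \<delta>)" "ptarget (\<gamma>1 \<star> \<delta>) = psource \<gamma>2"
    using path_map_pconcat[OF r(1) path_map_null_loop[OF r(2)] r(4)] ptarget_null_loop[OF r(2)] r(5)
    by simp_all
  then show ?thesis using r by (intro that) simp_all
qed

lemma signature_elem_step:
  assumes "elem_step G \<alpha> \<beta>"
  shows "signature (step_functionals \<alpha>) = signature (step_functionals \<beta>)"
  using assms
proof (rule elem_stepE)
  fix \<gamma>1 \<delta> \<gamma>2
  assume r: "path_map G \<gamma>1" "null_loop G \<delta>" "path_map G \<gamma>2"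
    "ptarget \<gamma>1 = psource \<delta>" "psource \<delta> = psource \<gamma>2" "ptarget \<gamma>1 = psource \<gamma>2"
    "path_map G (\<gamma>1 \<star> \<delta>)" "ptarget (\<gamma>1 \<star> \<delta>) = psource \<gamma>2"
    and eq: "\<alpha> = \<gamma>1 \<star> \<delta> \<star> \<gamma>2" "\<beta> = \<gamma>1 \<star> \<gamma>2"
  note \<delta> = null_loop[OF r(2)]
  show ?thesis
    unfolding eq signature_pconcat[OF r(7,3,8)] signature_pconcat[OF r(1) \<delta>(1) r(4)]
      signature_pconcat[OF r(1,3,6)] \<delta>(3) deconc_prod_assoc by simp
qed

lemma elem_step_target:
  assumes "elem_step G \<alpha> \<beta>"
  shows "ptarget \<alpha> = ptarget \<beta>"
  using assms by (rule elem_stepE) (simp add: path_map_pconcat(4))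

lemma elem_step_pconcat_right:
  assumes "elem_step G \<alpha> \<beta>" "path_map G \<epsilon>" "ptarget \<beta> = psource \<epsilon>"
  shows "elem_step G (\<alpha> \<star> \<epsilon>) (\<beta> \<star> \<epsilon>)"
  using assms(1)
proof (rule elem_stepE)
  fix \<gamma>1 \<delta> \<gamma>2
  assume r: "path_map G \<gamma>1" "null_loop G \<delta>" "path_map G \<gamma>2"
    "ptarget \<gamma>1 = psource \<delta>" "psource \<delta> = psource \<gamma>2" "ptarget \<gamma>1 = psource \<gamma>2"
    "path_map G (\<gamma>1 \<star> \<delta>)"
    and eq: "\<alpha> = \<gamma>1 \<star> \<delta> \<star> \<gamma>2" "\<beta> = \<gamma>1 \<star> \<gamma>2"
  have "ptarget \<gamma>2 = psource \<epsilon>"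
    using path_map_pconcat(4)[OF r(1,3,6)] assms(3) eq(2) by simp
  note c = path_map_pconcat[OF r(3) assms(2) this]
  show ?thesis
    unfolding eq pconcat_assoc[OF r(7,3) assms(2)] pconcat_assoc[OF r(1,3) assms(2)] elem_step_iff
    using r c by metis
qed

lemma elem_equiv_refl: "elem_equiv G \<alpha> \<alpha>"
  and elem_equiv_sym: "elem_equiv G \<alpha> \<beta> \<Longrightarrow> elem_equiv G \<beta> \<alpha>"
  and elem_equiv_trans: "elem_equiv G \<alpha> \<beta> \<Longrightarrow> elem_equiv G \<beta> \<gamma> \<Longrightarrow> elem_equiv G \<alpha> \<gamma>"
  and elem_equiv_step: "elem_step G \<alpha> \<beta> \<Longrightarrow> elem_equiv G \<alpha> \<beta>"
  unfolding elem_equiv_def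
  by (auto intro: equivclp_sym equivclp_trans r_into_equivclp)

lemma signature_elem_equiv:
  assumes "elem_equiv G \<alpha> \<beta>"
  shows "signature (step_functionals \<alpha>) = signature (step_functionals \<beta>)"
  using assms unfolding elem_equiv_def
proof (induction rule: equivclp_induct)
  case (step \<beta> \<gamma>)
  then show ?case by (metis signature_elem_step)
qed simp

lemma elem_equiv_pconcat_right:
  assumes "elem_equiv G \<alpha> \<beta>" "path_map G \<delta>" "ptarget \<alpha> = psource \<delta>"
  shows "elem_equiv G (\<alpha> \<star> \<delta>) (\<beta> \<star> \<delta>)"
proof -
  have "ptarget \<beta> = psource \<delta> \<and> elem_equiv G (\<alpha> \<star> \<delta>) (\<beta> \<star> \<delta>)"
    using assms(1) unfolding elem_equiv_def
  proof (induction rule: equivclp_induct)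
    case base
    then show ?case using assms(3) by simp
  next
    case (step \<beta> \<gamma>)
    have ends: "ptarget \<gamma> = psource \<delta>" using step elem_step_target by metis
    have "elem_step G (\<beta> \<star> \<delta>) (\<gamma> \<star> \<delta>) \<or> elem_step G (\<gamma> \<star> \<delta>) (\<beta> \<star> \<delta>)"
      using step(2,3) ends assms(2) elem_step_pconcat_right by blast
    with step(3) ends show ?case
      by (meson equivclp_sym equivclp_trans r_into_equivclp)
  qed
  then show ?thesis by simp
qed

section \<open>Paths with trivial signature are null\<close>

text \<open>
  The form dual to the arrow \<open>c\<close>; for the arrows of \<open>G\<close> these forms play the part of \<open>\<chi>\<close> above.
\<close>
definition edge_form :: "'a pair_pre_digraph \<Rightarrow> 'a \<times> 'a \<Rightarrow> 'a \<times> 'a \<Rightarrow> 'k::field_char_0" where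
  "edge_form G c = (\<lambda>a\<in>parcs G. if a = c then 1 else 0)"

text \<open>
  Two consecutive steps have the same generator with opposite signs only if they traverse one
  arrow back and forth. So a path without constant steps and without backtracking spells a
  reduced word in the arrows of \<open>G\<close>, where \<open>u \<rightarrow> v\<close> and \<open>v \<rightarrow> u\<close> are independent generators.
\<close>
lemma signature_reduced_path_neq_1:
  assumes "path_map G \<gamma>" "plen \<gamma> > 0"
    and nontriv: "\<And>i. i < plen \<gamma> \<Longrightarrow> pmap \<gamma> i \<noteq> pmap \<gamma> (Suc i)"
    and nonback: "\<And>i. Suc i < plen \<gamma> \<Longrightarrow> pmap \<gamma> (Suc (Suc i)) = pmap \<gamma> i \<Longrightarrow>
      forward \<gamma> (Suc i) \<longleftrightarrow> forward \<gamma> i"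
  obtains \<omega>s :: "('a \<times> 'a \<Rightarrow> 'k::field_char_0) list"
  where "set \<omega>s \<subseteq> one_forms G" "\<omega>s \<noteq> []" "signature (step_functionals \<gamma>) \<omega>s \<noteq> 0"
proof -
  obtain n F p where g: "\<gamma> = make_path n F p" by (rule path_cases[OF assms(1)])
  define letter where "letter i = (if F i then (1 :: 'k, (p i, p (Suc i))) else (- 1, (p (Suc i), p i)))" for i
  define l where "l = map letter [0..<n]"
  have l: "length l = n" "i < n \<Longrightarrow> l ! i = letter i" for i
    by (simp_all add: l_def)
  have nt: "p i \<noteq> p (Suc i)" if "i < n" for i using nontriv[of i] that by (simp add: g)
  have nb: "F (Suc i) \<longleftrightarrow> F i" if "Suc i < n" "p (Suc (Suc i)) = p i" for i
    using nonback[of i] that by (simp add: g)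
  have steps: "step_functionals \<gamma> = map letter_functional l"
  proof (rule nth_equalityI)
    fix i assume "i < length (step_functionals \<gamma> :: (('a \<times> 'a \<Rightarrow> 'k) \<Rightarrow> 'k) list)"
    then have i: "i < n" by (simp add: g)
    then show "(step_functionals \<gamma> :: (('a \<times> 'a \<Rightarrow> 'k) \<Rightarrow> 'k) list) ! i = map letter_functional l ! i"
      using nt[OF i]
      by (auto simp: g l nth_step_functionals pairing_Suc_make_path letter_def letter_functional_def)
  qed (simp add: g l)
  have arcs: "snd ` set l \<subseteq> parcs G"
  proof -
    have "snd (letter i) \<in> parcs G" if "i < n" for i
      using assms(1) nt[OF that] that by (auto simp: g path_map_make_path_iff letter_def)
    then show ?thesis by (auto simp: l_def)
  qed
  have "reduced_word l"
    unfolding reduced_word_def successively_conv_nth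
  proof (intro conjI allI impI)
    show "\<forall>(e, a)\<in>set l. e \<noteq> 0" by (auto simp: l_def letter_def)
    fix i assume "Suc i < length l"
    then have i: "i < n" "Suc i < n" by (simp_all add: l)
    show "(case l ! i of (e, a) \<Rightarrow> \<lambda>(e', a'). a = a' \<longrightarrow> e = e') (l ! Suc i)"
      using nt[OF i(1)] nt[OF i(2)] nb[OF i(2)] by (auto simp: l i letter_def)
  qed
  moreover have "l \<noteq> []" using assms(2) l(1) by (auto simp: g)
  moreover note arcs
  ultimately have "signature (map letter_functional l) (map (edge_form G) (remdups_adj (map snd l))) \<noteq> 0"
    by (intro signature_reduced_word_neq_0[where A = "parcs G"]) (auto simp: edge_form_def)
  with \<open>l \<noteq> []\<close> show ?thesis
    by (intro that[of "map (edge_form G) (remdups_adj (map snd l))"])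
      (auto simp: steps one_forms_def edge_form_def)
qed

text \<open>
  If all iterated integrals of positive degree vanish, then a path of positive length is not
  reduced, so it contains a constant step or a backtracking, and deleting that gives a shorter
  path with the same integrals.
\<close>
lemma elem_equiv_const_path:
  fixes \<gamma> :: "'a dpath"
  assumes "path_map G \<gamma>"
    and "\<And>\<omega>s :: ('a \<times> 'a \<Rightarrow> 'k::field_char_0) list. set \<omega>s \<subseteq> one_forms G \<Longrightarrow>
      signature (step_functionals \<gamma>) \<omega>s = deconc_one \<omega>s"
  shows "elem_equiv G \<gamma> (const_path (psource \<gamma>))"
  using assms
proof (induction "plen \<gamma>" arbitrary: \<gamma> rule: less_induct)
  case less
  have shorter: "elem_equiv G \<gamma> (const_path (psource \<gamma>))"
    if step: "elem_step G \<gamma> (\<gamma>1 \<star> \<gamma>2)" and "path_map G \<gamma>1" "path_map G \<gamma>2" "ptarget \<gamma>1 = psource \<gamma>2"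
      and "plen \<gamma>1 + plen \<gamma>2 < plen \<gamma>" "psource \<gamma>1 = psource \<gamma>" for \<gamma>1 \<gamma>2
  proof -
    note c = path_map_pconcat[OF that(2-4)]
    have "elem_equiv G (\<gamma>1 \<star> \<gamma>2) (const_path (psource (\<gamma>1 \<star> \<gamma>2)))"
      using less.prems(2) c that(5)
      by (intro less.hyps) (simp_all flip: signature_elem_step[OF step])
    with elem_equiv_step[OF step] show ?thesis
      using c(3) that(6) by (metis elem_equiv_trans)
  qed
  consider "plen \<gamma> = 0"
    | i where "i < plen \<gamma>" "pmap \<gamma> i = pmap \<gamma> (Suc i)"
    | i where "Suc i < plen \<gamma>" "pmap \<gamma> (Suc (Suc i)) = pmap \<gamma> i" "forward \<gamma> (Suc i) \<longleftrightarrow> \<not> forward \<gamma> i"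
    | "plen \<gamma> > 0" "\<And>i. i < plen \<gamma> \<Longrightarrow> pmap \<gamma> i \<noteq> pmap \<gamma> (Suc i)"
      "\<And>i. Suc i < plen \<gamma> \<Longrightarrow> pmap \<gamma> (Suc (Suc i)) = pmap \<gamma> i \<Longrightarrow> forward \<gamma> (Suc i) \<longleftrightarrow> forward \<gamma> i"
    by blast
  then show ?case
  proof cases
    case 1
    then show ?thesis using path_map_plen_0[OF less.prems(1)] elem_equiv_refl by metis
  next
    case (2 i)
    let ?n = "plen \<gamma>"
    have split: "subpath \<gamma> 0 i \<star> subpath \<gamma> i (Suc i) \<star> subpath \<gamma> (Suc i) ?n = \<gamma>"
      using 2 subpath_full[OF less.prems(1)] by (simp add: subpath_pconcat)
    have "elem_step G (subpath \<gamma> 0 i \<star> subpath \<gamma> i (Suc i) \<star> subpath \<gamma> (Suc i) ?n)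
        (subpath \<gamma> 0 i \<star> subpath \<gamma> (Suc i) ?n)"
      using 2 path_map_subpath[OF less.prems(1)]
      by (intro elem_step.trivial) (auto simp: trivial_arrow_def)
    then show ?thesis unfolding split
      by (rule shorter) (use 2 path_map_subpath[OF less.prems(1)] in \<open>auto simp: psource_def[of \<gamma>]\<close>)
  next
    case (3 i)
    let ?n = "plen \<gamma>" and ?j = "Suc (Suc i)"
    have split: "subpath \<gamma> 0 i \<star> subpath \<gamma> i (Suc i) \<star> pinverse (subpath \<gamma> i (Suc i)) \<star> subpath \<gamma> ?j ?n = \<gamma>"
      using 3 subpath_full[OF less.prems(1)] subpath_backtrack[OF 3(2,3)]
      by (simp add: subpath_pconcat flip: subpath_backtrack)
    have "elem_step G (subpath \<gamma> 0 i \<star> subpath \<gamma> i (Suc i) \<star> pinverse (subpath \<gamma> i (Suc i)) \<star> subpath \<gamma> ?j ?n)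
        (subpath \<gamma> 0 i \<star> subpath \<gamma> ?j ?n)"
      using 3 path_map_subpath[OF less.prems(1)] by (intro elem_step.cancel) auto
    then show ?thesis unfolding split
      by (rule shorter) (use 3 path_map_subpath[OF less.prems(1)] in \<open>auto simp: psource_def[of \<gamma>]\<close>)
  next
    case 4
    obtain \<omega>s :: "('a \<times> 'a \<Rightarrow> 'k) list" where
      "set \<omega>s \<subseteq> one_forms G" "\<omega>s \<noteq> []" "signature (step_functionals \<gamma>) \<omega>s \<noteq> 0"
      by (rule signature_reduced_path_neq_1[OF less.prems(1) 4])
    then show ?thesis using less.prems(2)[of \<omega>s] by (simp add: deconc_one_def)
  qed
qed

theorem theorem1p1:
  fixes G :: "'a pair_pre_digraph" and x y :: 'a and \<alpha> \<beta> :: "'a dpath"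
  assumes "pair_digraph G"
    and "x \<in> pverts G" and "y \<in> pverts G"
    and "path_map_from_to G x y \<alpha>" and "path_map_from_to G x y \<beta>"
  shows "elem_equiv G \<alpha> \<beta> \<longleftrightarrow>
    (\<forall>r\<ge>1. \<forall>\<omega>s :: ('a \<times> 'a \<Rightarrow> 'k::field_char_0) list.
       length \<omega>s = r \<and> set \<omega>s \<subseteq> one_forms G \<longrightarrow>
       iterated_integral \<alpha> \<omega>s = iterated_integral \<beta> \<omega>s)"
proof
  assume "elem_equiv G \<alpha> \<beta>"
  then show "\<forall>r\<ge>1. \<forall>\<omega>s :: ('a \<times> 'a \<Rightarrow> 'k) list. length \<omega>s = r \<and> set \<omega>s \<subseteq> one_forms G \<longrightarrow>
      iterated_integral \<alpha> \<omega>s = iterated_integral \<beta> \<omega>s"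
    by (simp add: iterated_integral_eq_signature signature_elem_equiv)
next
  assume int: "\<forall>r\<ge>1. \<forall>\<omega>s :: ('a \<times> 'a \<Rightarrow> 'k) list. length \<omega>s = r \<and> set \<omega>s \<subseteq> one_forms G \<longrightarrow>
      iterated_integral \<alpha> \<omega>s = iterated_integral \<beta> \<omega>s"
  have a: "path_map G \<alpha>" "psource \<alpha> = x" "ptarget \<alpha> = y"
    and b: "path_map G \<beta>" "psource \<beta> = x" "ptarget \<beta> = y"
    using assms by (auto simp: path_map_from_to_def)
  note inv = path_map_pinverse[OF b(1)]
  let ?\<gamma> = "\<alpha> \<star> pinverse \<beta>"
  have ends: "ptarget \<alpha> = psource (pinverse \<beta>)" using a b inv by simp
  note g = path_map_pconcat[OF a(1) inv(1) ends]
  \<comment> \<open>The empty word has coefficient 1 in every signature, which settles \<open>r = 0\<close>.\<close>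
  have eq: "signature (step_functionals \<alpha>) \<omega>s = signature (step_functionals \<beta>) \<omega>s"
    if "set \<omega>s \<subseteq> one_forms G" for \<omega>s :: "('a \<times> 'a \<Rightarrow> 'k) list"
  proof (cases \<omega>s)
    case (Cons \<omega> \<omega>s')
    then have "length \<omega>s \<ge> 1" by simp
    then have "iterated_integral \<alpha> \<omega>s = iterated_integral \<beta> \<omega>s" using int that by blast
    then show ?thesis by (simp add: iterated_integral_eq_signature)
  qed simp
  \<comment> \<open>The coefficients of \<open>\<alpha>\<close> may be replaced by those of \<open>\<beta>\<close> inside the product, since prefixes
      of a word of forms on \<open>G\<close> are again words of forms on \<open>G\<close>.\<close>
  have "signature (step_functionals ?\<gamma>) \<omega>s = deconc_one \<omega>s"
    if "set \<omega>s \<subseteq> one_forms G" for \<omega>s :: "('a \<times> 'a \<Rightarrow> 'k) list"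
  proof -
    have "signature (step_functionals ?\<gamma>) \<omega>s =
        (signature (step_functionals \<beta>) \<diamondop> signature (step_functionals (pinverse \<beta>))) \<omega>s"
      unfolding signature_pconcat[OF a(1) inv(1) ends] deconc_prod_def
      using that by (intro sum.cong refl arg_cong2[where f = "(*)"] eq) (auto dest: in_set_takeD)
    then show ?thesis by (simp add: signature_pinverse[OF b(1)])
  qed
  then have "elem_equiv G ?\<gamma> (const_path x)"
    using elem_equiv_const_path[OF g(1)] a(2) g(3) by metis
  then have "elem_equiv G (?\<gamma> \<star> \<beta>) (const_path x \<star> \<beta>)"
    using b inv g by (intro elem_equiv_pconcat_right) simp_all
  moreover have "const_path x \<star> \<beta> = \<beta>" using pconcat_const_path(2)[OF b(1)] b by simp
  moreover have "elem_equiv G (?\<gamma> \<star> \<beta>) \<alpha>"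
  proof -
    have t: "ptarget (?\<gamma> \<star> \<beta>) = y" "path_map G (?\<gamma> \<star> \<beta>)"
      using path_map_pconcat[OF g(1) b(1)] g(4) inv b by simp_all
    \<comment> \<open>The cancelled path is the inverse of \<open>\<beta>\<close>, whose own inverse is \<open>\<beta>\<close>.\<close>
    have "elem_step G (\<alpha> \<star> pinverse \<beta> \<star> pinverse (pinverse \<beta>) \<star> const_path y) (\<alpha> \<star> const_path y)"
      using a inv b assms(3) by (intro elem_step.cancel) (simp_all add: path_map_const_path)
    then have "elem_step G (?\<gamma> \<star> \<beta>) \<alpha>"
      using pconcat_const_path(1)[OF t(2)] pconcat_const_path(1)[OF a(1)] t a inv(5) by simp
    then show ?thesis by (rule elem_equiv_step)
  qed
  ultimately show "elem_equiv G \<alpha> \<beta>"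
    by (metis elem_equiv_sym elem_equiv_trans)
qed

end
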